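(* (Weak $\chi^2$ inequality.) Let $A$ be a real symmetric positive-definite $n\times n$ matrix, $\underline{\boldsymbol{x}}\sim N(\underline 0,I_n)$ and $\boldsymbol{\Delta}=\underline{\boldsymbol{x}}^{\mathsf T}A\underline{\boldsymbol{x}}-\mathrm{tr}(A)$. Then for every $t>0$, $$\Pr(\boldsymbol{\Delta}>t)\le1-F_{\chi^2_n}\Big(1+\frac{t}{\|A\|}\Big).$$
   Context: $\|A\|$ is the operator norm of $A$ and $F_{\chi^2_n}$ is the CDF of a $\chi^2$ random variable with $n$ degrees of freedom. *)

theory Defs
  imports "HOL-Probability.Probability"
begin

definition symmetric_matrix :: "real^'n^'n \<Rightarrow> bool" where
  "symmetric_matrix A \<longleftrightarrow> transpose A = A"

definition positive_definite :: "real^'n^'n \<Rightarrow> bool" where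
  "positive_definite A \<longleftrightarrow> (\<forall>v. v \<noteq> 0 \<longrightarrow> v \<bullet> (A *v v) > 0)"

text \<open>Lebesgue density of \<open>N(\<mu>, \<Sigma>)\<close>; meaningful for symmetric positive definite
  \<open>\<Sigma>\<close> only.\<close>

definition mvnormal_density :: "real^'n \<Rightarrow> real^'n^'n \<Rightarrow> real^'n \<Rightarrow> real" where
  "mvnormal_density \<mu> \<Sigma> v =
     exp (- ((v - \<mu>) \<bullet> (matrix_inv \<Sigma> *v (v - \<mu>))) / 2) / sqrt ((2 * pi) ^ CARD('n) * det \<Sigma>)"

text \<open>The law of the sum of the squares of \<open>n\<close> independent standard normal variables.\<close>

definition chi_square :: "nat \<Rightarrow> real measure" where
  "chi_square n =
     distr (\<Pi>\<^sub>M i\<in>{..<n}. std_normal_distribution) borel (\<lambda>z. \<Sum>i<n. (z i)\<^sup>2)"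

end

theory Submission
  imports Defs
begin

text \<open>
  Write \<open>L\<close> for the operator norm of \<open>A\<close>. Two deterministic facts reduce the claim to a tail
  of \<open>\<bar>x\<bar>\<^sup>2\<close>: the form satisfies \<open>x \<bullet> A x \<le> L \<bar>x\<bar>\<^sup>2\<close>, and \<open>L \<le> tr A\<close>, because the trace is the
  sum of all eigenvalues, which are positive, while \<open>L\<close> is only the largest one. Hence \<open>x \<bullet> A x - tr A > t\<close>
  forces \<open>L \<bar>x\<bar>\<^sup>2 > t + L\<close>, that is \<open>\<bar>x\<bar>\<^sup>2 > 1 + t / L\<close>, and \<open>\<bar>x\<bar>\<^sup>2\<close> has the chi-square law since
  the coordinates of a standard Gaussian vector are independent standard normal variables.

  Instead of diagonalizing \<open>A\<close>, lemma \<open>onorm_le_trace\<close> derives \<open>L \<le> tr A\<close> from the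
  Cauchy-Schwarz inequality for the form of \<open>A\<close>. The law of \<open>\<bar>x\<bar>\<^sup>2\<close> is found in
  \<open>distr_norm_squared_mvnormal\<close> by identifying the law of the coordinates with a product measure.
\<close>

section \<open>Positive definite forms, trace and operator norm\<close>

lemma positive_definite_nonneg:
  assumes "positive_definite A"
  shows "0 \<le> v \<bullet> (A *v v)"
  using assms by (cases "v = 0") (auto simp: positive_definite_def less_imp_le)

text \<open>The form is nonnegative at the multiple \<open>q(v) u - (u \<bullet> A v) v\<close> of the component of \<open>u\<close>
  that is orthogonal to \<open>v\<close> with respect to \<open>A\<close>, where \<open>q(v) = v \<bullet> A v\<close>; its value there
  is \<open>q(v)\<close> times the difference of the two sides.\<close>

lemma positive_definite_Cauchy_Schwarz:
  assumes "symmetric_matrix A" and "positive_definite A"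
  shows "(u \<bullet> (A *v v))\<^sup>2 \<le> (u \<bullet> (A *v u)) * (v \<bullet> (A *v v))"
proof (cases "v = 0")
  case False
  define p q r where "p = u \<bullet> (A *v u)" and "q = v \<bullet> (A *v v)" and "r = u \<bullet> (A *v v)"
  have "q > 0"
    using False assms(2) by (simp add: positive_definite_def q_def)
  have "v \<bullet> (A *v u) = r"
    using assms(1) by (metis symmetric_matrix_def r_def dot_lmul_matrix inner_commute
        vector_transpose_matrix)
  then have "(q *\<^sub>R u - r *\<^sub>R v) \<bullet> (A *v (q *\<^sub>R u - r *\<^sub>R v)) = q * (p * q - r\<^sup>2)"
    by (simp add: matrix_vector_mult_diff_distrib matrix_vector_mult_scaleR inner_diff_left
        inner_diff_right p_def[symmetric] q_def[symmetric] r_def[symmetric] power2_eq_square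
        algebra_simps)
  then have "0 \<le> q * (p * q - r\<^sup>2)"
    using positive_definite_nonneg[OF assms(2)] by metis
  then show ?thesis
    using \<open>q > 0\<close> by (simp add: zero_le_mult_iff p_def q_def r_def)
qed simp

lemma norm_squared_vec: "(norm v)\<^sup>2 = (\<Sum>i\<in>UNIV. (v $ i)\<^sup>2)" for v :: "real^'n"
  by (simp add: norm_vec_def L2_set_def sum_nonneg)

text \<open>Cauchy-Schwarz against each coordinate vector bounds \<open>((A v) $ i)\<^sup>2\<close> by
  \<open>A $ i $ i * (v \<bullet> A v)\<close>. Summing over \<open>i\<close> gives
  \<open>\<bar>A v\<bar>\<^sup>2 \<le> tr A * (v \<bullet> A v) \<le> tr A * \<bar>v\<bar> * \<bar>A v\<bar>\<close>.\<close>

lemma onorm_le_trace: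
  fixes A :: "real^'n^'n"
  assumes "symmetric_matrix A" and "positive_definite A"
  shows "onorm ((*v) A) \<le> trace A"
proof (rule onorm_le)
  fix v :: "real^'n"
  have diag: "axis i 1 \<bullet> (A *v axis i 1) = A $ i $ i" for i
    by (simp add: inner_axis' matrix_vector_mul_component inner_axis)
  have tr: "0 \<le> trace A"
    unfolding trace_def diag[symmetric]
    by (intro sum_nonneg positive_definite_nonneg assms)
  have "(norm (A *v v))\<^sup>2 = (\<Sum>i\<in>UNIV. (axis i 1 \<bullet> (A *v v))\<^sup>2)"
    by (simp add: norm_squared_vec inner_axis')
  also have "\<dots> \<le> (\<Sum>i\<in>UNIV. A $ i $ i * (v \<bullet> (A *v v)))"
    unfolding diag[symmetric]
    by (intro sum_mono positive_definite_Cauchy_Schwarz assms)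
  also have "\<dots> = trace A * (v \<bullet> (A *v v))"
    by (simp add: trace_def sum_distrib_right)
  also have "\<dots> \<le> trace A * (norm v * norm (A *v v))"
    by (intro mult_left_mono norm_cauchy_schwarz tr)
  finally have "norm (A *v v) * norm (A *v v) \<le> (trace A * norm v) * norm (A *v v)"
    by (simp add: power2_eq_square mult_ac)
  then show "norm (A *v v) \<le> trace A * norm v"
    using tr by (cases "norm (A *v v) = 0") (auto simp: mult_le_cancel_right)
qed

lemma onorm_pos_of_positive_definite:
  fixes A :: "real^'n^'n"
  assumes "positive_definite A"
  shows "0 < onorm ((*v) A)"
proof -
  have "axis undefined 1 \<noteq> (0 :: real^'n)"
    by (simp add: axis_eq_0_iff)
  then have "A *v axis undefined 1 \<noteq> 0"
    using assms by (metis inner_zero_right less_irrefl positive_definite_def)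
  then show ?thesis
    using onorm_pos_lt[OF matrix_vector_mul_bounded_linear, of A] by blast
qed

lemma quadratic_form_le_onorm:
  fixes A :: "real^'n^'n"
  shows "v \<bullet> (A *v v) \<le> onorm ((*v) A) * (norm v)\<^sup>2"
proof -
  have "v \<bullet> (A *v v) \<le> norm v * norm (A *v v)"
    by (rule norm_cauchy_schwarz)
  also have "\<dots> \<le> norm v * (onorm ((*v) A) * norm v)"
    by (intro mult_left_mono onorm matrix_vector_mul_bounded_linear norm_ge_zero)
  finally show ?thesis
    by (simp add: power2_eq_square mult_ac)
qed

section \<open>The squared norm of a standard Gaussian vector\<close>

lemma mvnormal_density_standard:
  fixes v :: "real^'n"
  shows "mvnormal_density 0 (mat 1) v = (\<Prod>i\<in>UNIV. std_normal_density (v $ i))"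
proof -
  have inv: "matrix_inv (mat 1 :: real^'n^'n) = mat 1"
    unfolding matrix_inv_def by (rule some_equality) simp_all
  have "(\<Prod>i\<in>UNIV. std_normal_density (v $ i))
      = exp (\<Sum>i\<in>UNIV. - ((v $ i)\<^sup>2 / 2)) / sqrt (2 * pi) ^ CARD('n)"
    by (simp add: std_normal_density_def prod_dividef exp_sum prod.distrib power_divide)
  also have "(\<Sum>i\<in>UNIV. - ((v $ i)\<^sup>2 / 2)) = - (v \<bullet> v) / 2"
    by (simp add: inner_vec_def sum_negf sum_divide_distrib power2_eq_square)
  finally show ?thesis
    unfolding mvnormal_density_def inv det_I mult_1_right real_sqrt_power by simp
qed

text \<open>Measures on the product space are determined by their values on boxes, and on a box the
  Gaussian density integrates to a product by Fubini's theorem. The enumeration \<open>h\<close> of the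
  coordinates matches the index type with the index set of \<^const>\<open>chi_square\<close>.\<close>

lemma distr_coordinates_mvnormal:
  fixes h :: "nat \<Rightarrow> 'n::finite"
  assumes h: "bij_betw h {..<CARD('n)} UNIV"
  shows "distr (density lborel (mvnormal_density 0 (mat 1))) (\<Pi>\<^sub>M i\<in>{..<CARD('n)}. std_normal_distribution)
           (\<lambda>v :: real^'n. \<lambda>i\<in>{..<CARD('n)}. v $ h i)
         = (\<Pi>\<^sub>M i\<in>{..<CARD('n)}. std_normal_distribution)"
    (is "distr ?G ?P ?f = ?P")
proof -
  interpret N: prob_space std_normal_distribution
    by (rule prob_space_normal_density) simp
  interpret product_sigma_finite "\<lambda>_::nat. std_normal_distribution"
    by standard
  have meas_coord: "(\<lambda>v :: real^'n. v $ j) \<in> borel_measurable borel" for j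
    by (intro borel_measurable_continuous_onI continuous_intros)
  have dens: "(\<lambda>v :: real^'n. ennreal (mvnormal_density 0 (mat 1) v)) \<in> borel_measurable lborel"
    unfolding mvnormal_density_standard using meas_coord by measurable
  have f: "?f \<in> measurable ?G ?P"
    using meas_coord by (intro measurable_restrict) simp
  show ?thesis
  proof (rule PiM_eqI)
    fix E :: "nat \<Rightarrow> real set"
    assume "\<And>i. i \<in> {..<CARD('n)} \<Longrightarrow> E i \<in> sets std_normal_distribution"
    then have E: "E i \<in> sets borel" if "i < CARD('n)" for i
      using that by simp
    define g where "g = inv_into {..<CARD('n)} h"
    have g: "g j < CARD('n)" "h (g j) = j" for j
      using h unfolding g_def
      by (metis bij_betw_imp_surj_on inv_into_into lessThan_iff UNIV_I)
        (metis h bij_betw_inv_into_right UNIV_I)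
    have gh: "g (h i) = i" if "i < CARD('n)" for i
      using that h unfolding g_def by (simp add: bij_betw_inv_into_left)
    define F :: "'n \<Rightarrow> real \<Rightarrow> ennreal" where
      "F = (\<lambda>j y. ennreal (std_normal_density y) * indicator (E (g j)) y)"
    have F: "F j \<in> borel_measurable borel" for j
      using E[OF g(1)[of j]] unfolding F_def by measurable
    have inj: "inj (\<lambda>j. axis j (1::real) :: real^'n)"
      by (auto simp: inj_on_def axis_eq_axis)
    have Basis: "(Basis :: (real^'n) set) = range (\<lambda>j. axis j 1)"
      by (auto simp: Basis_vec_def)
    \<comment> \<open>the index of a basis vector, so that the factors can be indexed by \<open>Basis\<close>\<close>
    define idx :: "real^'n \<Rightarrow> 'n" where "idx = inv (\<lambda>j. axis j 1)"
    have idx: "idx (axis j 1) = j" for j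
      unfolding idx_def by (rule inv_f_f[OF inj])
    have "emeasure (distr ?G ?P ?f) (Pi\<^sub>E {..<CARD('n)} E) = emeasure ?G (?f -` Pi\<^sub>E {..<CARD('n)} E)"
      using E by (subst emeasure_distr[OF f]) (auto intro!: sets_PiM_I_finite)
    also have "?f -` Pi\<^sub>E {..<CARD('n)} E = {v. \<forall>j. v $ j \<in> E (g j)}"
    proof (rule set_eqI)
      fix v :: "real^'n"
      have "v \<in> ?f -` Pi\<^sub>E {..<CARD('n)} E \<longleftrightarrow> (\<forall>i\<in>{..<CARD('n)}. v $ h i \<in> E (g (h i)))"
        by (simp add: PiE_iff Ball_def gh)
      also have "\<dots> \<longleftrightarrow> (\<forall>j\<in>h ` {..<CARD('n)}. v $ j \<in> E (g j))"
        by blast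
      also have "\<dots> \<longleftrightarrow> v \<in> {v. \<forall>j. v $ j \<in> E (g j)}"
        by (simp add: bij_betw_imp_surj_on[OF h])
      finally show "v \<in> ?f -` Pi\<^sub>E {..<CARD('n)} E \<longleftrightarrow> v \<in> {v. \<forall>j. v $ j \<in> E (g j)}" .
    qed
    also have "emeasure ?G {v. \<forall>j. v $ j \<in> E (g j)}
        = (\<integral>\<^sup>+v. ennreal (mvnormal_density 0 (mat 1) v)
              * indicator {v. \<forall>j. v $ j \<in> E (g j)} v \<partial>lborel)"
    proof (rule emeasure_density[OF dens])
      have "{v :: real^'n. \<forall>j. v $ j \<in> E (g j)} = (\<Inter>j. (\<lambda>v. v $ j) -` E (g j) \<inter> space borel)"
        by auto
      also have "\<dots> \<in> sets borel"
        using measurable_sets[OF meas_coord E[OF g(1)]] by (intro sets.finite_INT) auto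
      finally show "{v :: real^'n. \<forall>j. v $ j \<in> E (g j)} \<in> sets lborel"
        by simp
    qed
    also have "\<dots> = (\<integral>\<^sup>+v. (\<Prod>j\<in>UNIV. F j (v $ j)) \<partial>lborel)"
    proof (rule nn_integral_cong)
      fix v :: "real^'n"
      have "(indicator {v. \<forall>j. v $ j \<in> E (g j)} v :: ennreal)
          = (\<Prod>j\<in>UNIV. indicator (E (g j)) (v $ j))"
        by (auto simp: indicator_def prod_zero_iff)
      then show "ennreal (mvnormal_density 0 (mat 1) v) * indicator {v. \<forall>j. v $ j \<in> E (g j)} v
          = (\<Prod>j\<in>UNIV. F j (v $ j))"
        by (simp add: mvnormal_density_standard F_def prod.distrib prod_ennreal)
    qed
    also have "\<dots> = (\<integral>\<^sup>+v. (\<Prod>b\<in>Basis. F (idx b) (v \<bullet> b)) \<partial>lborel)"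
      unfolding Basis by (simp add: prod.reindex[OF inj] idx inner_axis)
    also have "\<dots> = (\<Prod>b\<in>(Basis :: (real^'n) set). \<integral>\<^sup>+y. F (idx b) y \<partial>lborel)"
      by (rule nn_integral_lborel_prod) (simp_all add: F)
    also have "\<dots> = (\<Prod>j\<in>UNIV. \<integral>\<^sup>+y. F j y \<partial>lborel)"
      unfolding Basis by (simp add: prod.reindex[OF inj] idx)
    also have "\<dots> = (\<Prod>j\<in>UNIV. emeasure std_normal_distribution (E (g j)))"
      unfolding F_def by (intro prod.cong refl, subst emeasure_density) (auto intro: E g)
    also have "\<dots> = (\<Prod>i\<in>{..<CARD('n)}. emeasure std_normal_distribution (E i))"
      by (subst prod.reindex_bij_betw[OF h, symmetric]) (simp add: gh)
    finally show "emeasure (distr ?G ?P ?f) (Pi\<^sub>E {..<CARD('n)} E)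
        = (\<Prod>i\<in>{..<CARD('n)}. emeasure std_normal_distribution (E i))" .
  qed simp_all
qed

lemma distr_norm_squared_mvnormal:
  "distr (density lborel (mvnormal_density 0 (mat 1))) borel (\<lambda>v :: real^'n. (norm v)\<^sup>2)
     = chi_square CARD('n)"
proof -
  let ?G = "density lborel (mvnormal_density 0 (mat 1)) :: (real^'n) measure"
  let ?P = "\<Pi>\<^sub>M i\<in>{..<CARD('n)}. std_normal_distribution"
  obtain h :: "nat \<Rightarrow> 'n" where h: "bij_betw h {..<CARD('n)} UNIV"
    using ex_bij_betw_nat_finite[of "UNIV :: 'n set"] by (auto simp: atLeast0LessThan)
  let ?f = "\<lambda>v :: real^'n. \<lambda>i\<in>{..<CARD('n)}. v $ h i"
  have meas_coord: "(\<lambda>v :: real^'n. v $ j) \<in> borel_measurable borel" for j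
    by (intro borel_measurable_continuous_onI continuous_intros)
  have f: "?f \<in> measurable ?G ?P"
    using meas_coord by (intro measurable_restrict) simp
  have sq: "(\<lambda>z. \<Sum>i<CARD('n). (z i)\<^sup>2) \<in> borel_measurable ?P"
  proof (intro borel_measurable_sum borel_measurable_power)
    fix i assume "i \<in> {..<CARD('n)}"
    then have "(\<lambda>z. z i) \<in> measurable ?P std_normal_distribution"
      by (rule measurable_component_singleton)
    then show "(\<lambda>z. z i) \<in> borel_measurable ?P"
      by simp
  qed
  have "(norm v)\<^sup>2 = (\<Sum>i<CARD('n). (?f v i)\<^sup>2)" for v :: "real^'n"
  proof -
    have "(norm v)\<^sup>2 = (\<Sum>j\<in>UNIV. (v $ j)\<^sup>2)"
      by (rule norm_squared_vec)
    also have "\<dots> = (\<Sum>i<CARD('n). (v $ h i)\<^sup>2)"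
      by (rule sum.reindex_bij_betw[OF h, symmetric])
    finally show ?thesis by simp
  qed
  then have "distr ?G borel (\<lambda>v. (norm v)\<^sup>2)
      = distr ?G borel ((\<lambda>z. \<Sum>i<CARD('n). (z i)\<^sup>2) \<circ> ?f)"
    by (simp add: comp_def)
  also have "\<dots> = distr (distr ?G ?P ?f) borel (\<lambda>z. \<Sum>i<CARD('n). (z i)\<^sup>2)"
    by (rule distr_distr[OF sq f, symmetric])
  also have "\<dots> = chi_square CARD('n)"
    by (simp only: distr_coordinates_mvnormal[OF h] chi_square_def)
  finally show ?thesis .
qed

section \<open>The weak chi-square inequality\<close>

theorem mainTheorem11:
  fixes A :: "real^'n^'n" and M :: "'a measure" and x :: "'a \<Rightarrow> real^'n" and t :: real
    and \<Delta> :: "'a \<Rightarrow> real"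
  assumes "symmetric_matrix A" and "positive_definite A"
    and "prob_space M"
    and "distributed M lborel x (mvnormal_density 0 (mat 1))"
    and "\<Delta> = (\<lambda>\<omega>. x \<omega> \<bullet> (A *v x \<omega>) - trace A)"
    and "t > 0"
  shows "measure M {\<omega> \<in> space M. \<Delta> \<omega> > t}
           \<le> 1 - cdf (chi_square CARD('n)) (1 + t / onorm ((*v) A))"
proof -
  interpret prob_space M by fact
  let ?L = "onorm ((*v) A)"
  let ?c = "1 + t / ?L"
  have L: "0 < ?L"
    by (rule onorm_pos_of_positive_definite[OF assms(2)])
  have x: "x \<in> measurable M borel"
    using distributed_measurable[OF assms(4)] by simp
  have S [measurable]: "(\<lambda>\<omega>. (norm (x \<omega>))\<^sup>2) \<in> borel_measurable M"
    using x by measurable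
  have "distr M borel (\<lambda>\<omega>. (norm (x \<omega>))\<^sup>2) = distr (distr M lborel x) borel (\<lambda>v. (norm v)\<^sup>2)"
    using distr_distr[of "\<lambda>v. (norm v)\<^sup>2" lborel borel x M] x by (simp add: comp_def)
  also have "\<dots> = chi_square CARD('n)"
    by (simp only: distributed_distr_eq_density[OF assms(4)] distr_norm_squared_mvnormal)
  finally have chi: "chi_square CARD('n) = distr M borel (\<lambda>\<omega>. (norm (x \<omega>))\<^sup>2)" ..
  have sub: "{\<omega> \<in> space M. \<Delta> \<omega> > t} \<subseteq> {\<omega> \<in> space M. \<not> (norm (x \<omega>))\<^sup>2 \<le> ?c}"
  proof clarify
    fix \<omega> assume "t < \<Delta> \<omega>" and le: "(norm (x \<omega>))\<^sup>2 \<le> ?c"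
    then have "t + ?L < ?L * (norm (x \<omega>))\<^sup>2"
      using quadratic_form_le_onorm[of "x \<omega>" A] onorm_le_trace[OF assms(1,2)] assms(5) by simp
    also have "\<dots> \<le> ?L * ?c"
      using le L by (intro mult_left_mono) auto
    finally show False
      using L by (simp add: distrib_left)
  qed
  have "measure M {\<omega> \<in> space M. \<Delta> \<omega> > t} \<le> prob {\<omega> \<in> space M. \<not> (norm (x \<omega>))\<^sup>2 \<le> ?c}"
    by (rule finite_measure_mono[OF sub]) measurable
  also have "\<dots> = 1 - prob {\<omega> \<in> space M. (norm (x \<omega>))\<^sup>2 \<le> ?c}"
    by (rule prob_neg) measurable
  also have "prob {\<omega> \<in> space M. (norm (x \<omega>))\<^sup>2 \<le> ?c} = cdf (chi_square CARD('n)) ?c"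
    unfolding chi cdf_def by (subst measure_distr[OF S]) (auto intro!: arg_cong[where f = prob])
  finally show ?thesis .
qed

end
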